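(* Let $q\ge4$ be even. The map $$\hat\pi\colon I_{R_q}\setminus\partial\mathcal{J}(f_q^\star)\to\mathcal{A}_q^{\mathrm{dreg}}\setminus\big\{\underline{b}\in\mathcal{A}_q^{\mathrm{dreg}}:\ \exists\,n\in\mathbb{Z}_{\ge0}:\ \tau^n(\underline{b})=\pm\underline{r}_q\big\}$$ defined by $\hat\pi(x)=\underline{b}=(b_i)_{i\in\mathbb{N}}$ if $(f_q^\star)^{i-1}(x)\in J^\star_{b_i}$ for all $i\in\mathbb{N}$, is bijective, and $\hat\pi\circ f_q^\star=\tau\circ\hat\pi$. Its inverse can be defined on the entire set $\mathcal{A}_q^{\mathrm{dreg}}$, as the map $\hat\pi^{-1}\colon\mathcal{A}_q^{\mathrm{dreg}}\to I_{R_q}$ given by $\hat\pi^{-1}(\underline{b})=[0;b_1,b_2,\dots]$.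
   Context: Let $q\ge4$ be even, $\lambda_q=2\cos(\pi/q)$, $h_q=\frac{q-2}{2}$, $R_q=1$, $r_q=1-\lambda_q$, and $I_{R_q}=[-R_q,R_q]$. For $x\ge0$ let $\langle x\rangle_q^\star$ be the integer $n$ with $n\lambda_q+r_q\le x<n\lambda_q+R_q$, and for $x<0$ put $\langle x\rangle_q^\star=-\langle-x\rangle_q^\star$. The map $f_q^\star\colon I_{R_q}\to I_{R_q}$ is $f_q^\star(y)=-\frac1y-\langle-\frac1y\rangle_q^\star\,\lambda_q$ for $y\ne0$, $f_q^\star(0)=0$. For $m\ge1$ let $J_m^\star=\big[\frac{-1}{r_q+m\lambda_q},\frac{-1}{r_q+(m+1)\lambda_q}\big]$ and $J_{-m}^\star=-J_m^\star$. Let $\partial\mathcal{J}(f_q^\star)=\{y\in I_{R_q}:\exists\,n\in\mathbb{Z}_{\ge0}\text{ with }(f_q^\star)^n(y)=\pm r_q\text{ or }(f_q^\star)^n(y)=0\}$. $(a)^k$ denotes $a$ repeated $k$ times and an overline marks a period. The forbidden blocks $\mathcal{B}_q$ for even $q$ are $((\pm1)^{h_q+1})$ and $((\pm1)^{h_q},\pm m)$, $m\ge1$ (same sign throughout each block). $\mathcal{A}_q^{\mathrm{dreg}}$ is the set of infinite sequences $(b_i)_{i\in\mathbb{N}}$ of nonzero integers which are dual $q$-regular: $(b_L,b_{L-1},\dots,b_l)\notin\mathcal{B}_q$ for all $1\le l<L$. $\tau$ is the shift $(\tau\underline{b})_i=b_{i+1}$. $\underline{r}_q=\overline{((1)^{h_q-1},2)}$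 and $-\underline{r}_q$ is its negative. The symbol $[0;b_1,b_2,\dots]$ denotes the limit as $n\to\infty$ of $\cfrac{-1}{b_1\lambda_q+\cfrac{-1}{b_2\lambda_q+\cdots+\cfrac{-1}{b_n\lambda_q}}}$. *)

theory Defs
  imports Complex_Main
begin

text \<open>
  The objects attached to the Hecke triangle group of index \<^term>\<open>q\<close>, in the form they take for
  even \<open>q \<ge> 4\<close>; the definitions are meaningful only for such \<^term>\<open>q\<close>.
\<close>

definition lambda_q :: "nat \<Rightarrow> real" where
  "lambda_q q = 2 * cos (pi / real q)"

definition h_q :: "nat \<Rightarrow> nat" where
  "h_q q = (q - 2) div 2"

definition R_q :: "nat \<Rightarrow> real" where
  "R_q q = 1"

definition r_q :: "nat \<Rightarrow> real" where
  "r_q q = 1 - lambda_q q"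

definition I_R :: "nat \<Rightarrow> real set" where
  "I_R q = {- R_q q .. R_q q}"

definition dual_floor_nonneg :: "nat \<Rightarrow> real \<Rightarrow> int" where
  "dual_floor_nonneg q x =
     (THE n. of_int n * lambda_q q + r_q q \<le> x \<and> x < of_int n * lambda_q q + R_q q)"

definition dual_floor :: "nat \<Rightarrow> real \<Rightarrow> int" where
  "dual_floor q x = (if x \<ge> 0 then dual_floor_nonneg q x else - dual_floor_nonneg q (- x))"

definition f_dual :: "nat \<Rightarrow> real \<Rightarrow> real" where
  "f_dual q y =
     (if y = 0 then 0 else - 1 / y - of_int (dual_floor q (- 1 / y)) * lambda_q q)"

definition J_dual_pos :: "nat \<Rightarrow> int \<Rightarrow> real set" where
  "J_dual_pos q m =
     {- 1 / (r_q q + of_int m * lambda_q q) .. - 1 / (r_q q + of_int (m + 1) * lambda_q q)}"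

text \<open>There is no interval with index 0; it is made empty, so that 0 never occurs as a digit.\<close>

definition J_dual :: "nat \<Rightarrow> int \<Rightarrow> real set" where
  "J_dual q m =
     (if m \<ge> 1 then J_dual_pos q m
      else if m \<le> - 1 then uminus ` J_dual_pos q (- m)
      else {})"

definition boundary_J :: "nat \<Rightarrow> real set" where
  "boundary_J q =
     {y \<in> I_R q. \<exists>n. (f_dual q ^^ n) y = r_q q \<or> (f_dual q ^^ n) y = - r_q q
                    \<or> (f_dual q ^^ n) y = 0}"

text \<open>
  Sequences \<open>b\<^sub>1, b\<^sub>2, \<dots>\<close> are functions on \<^typ>\<open>nat\<close> counted from 0: \<open>b\<^sub>i\<close> is \<open>b (i - 1)\<close>.
\<close>

definition forbidden_blocks :: "nat \<Rightarrow> int list set" where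
  "forbidden_blocks q =
     {replicate (h_q q + 1) s | s. s \<in> {1, - 1}} \<union>
     {replicate (h_q q) s @ [s * m] | s m. s \<in> {1, - 1} \<and> m \<ge> 1}"

text \<open>The list in the definition below is \<open>b L, b (L - 1), \<dots>, b l\<close>.\<close>

definition A_dreg :: "nat \<Rightarrow> (nat \<Rightarrow> int) set" where
  "A_dreg q =
     {b. (\<forall>i. b i \<noteq> 0) \<and>
         (\<forall>l L. l < L \<longrightarrow> map b (rev [l..<Suc L]) \<notin> forbidden_blocks q)}"

definition shift :: "(nat \<Rightarrow> int) \<Rightarrow> nat \<Rightarrow> int" where
  "shift b = (\<lambda>i. b (Suc i))"

definition periodic_seq :: "int list \<Rightarrow> nat \<Rightarrow> int" where
  "periodic_seq w = (\<lambda>i. w ! (i mod length w))"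

definition r_seq :: "nat \<Rightarrow> nat \<Rightarrow> int" where
  "r_seq q = periodic_seq (replicate (h_q q - 1) 1 @ [2])"

definition eventually_r :: "nat \<Rightarrow> (nat \<Rightarrow> int) set" where
  "eventually_r q =
     {b \<in> A_dreg q. \<exists>n. (shift ^^ n) b = r_seq q \<or> (shift ^^ n) b = (\<lambda>i. - r_seq q i)}"

definition is_coding :: "nat \<Rightarrow> real \<Rightarrow> (nat \<Rightarrow> int) \<Rightarrow> bool" where
  "is_coding q x b \<longleftrightarrow> (\<forall>i. (f_dual q ^^ i) x \<in> J_dual q (b i))"

definition pi_hat :: "nat \<Rightarrow> real \<Rightarrow> nat \<Rightarrow> int" where
  "pi_hat q x = (THE b. is_coding q x b)"

fun fin_cf :: "real \<Rightarrow> int list \<Rightarrow> real" where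
  "fin_cf lam [] = 0"
| "fin_cf lam (b # bs) = - 1 / (of_int b * lam + fin_cf lam bs)"

text \<open>
  Division is total, with \<open>x / 0 = 0\<close>; this predicate says that no denominator of the finite
  continued fraction vanishes.
\<close>

fun fin_cf_defined :: "real \<Rightarrow> int list \<Rightarrow> bool" where
  "fin_cf_defined lam [] \<longleftrightarrow> True"
| "fin_cf_defined lam (b # bs) \<longleftrightarrow>
     fin_cf_defined lam bs \<and> of_int b * lam + fin_cf lam bs \<noteq> 0"

definition convergent_cf :: "nat \<Rightarrow> (nat \<Rightarrow> int) \<Rightarrow> nat \<Rightarrow> real" where
  "convergent_cf q b n = fin_cf (lambda_q q) (map b [0..<n])"

definition inf_cf :: "nat \<Rightarrow> (nat \<Rightarrow> int) \<Rightarrow> real" where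
  "inf_cf q b = lim (convergent_cf q b)"

end

theory Submission
  imports Defs
begin

text \<open>
  Dual regularity of a sequence means that a nonzero digit is never followed by \<open>h_q\<close> digits 1 (or
  -1) of its own sign. The map \<open>S t = -1 / (\<lambda> + t)\<close>, which prepends a digit 1, sends 1 to \<open>r_q\<close> in
  \<open>h_q\<close> steps and then to -1, and it is increasing. Hence regularity of the digits corresponds
  exactly to the values after a positive digit being at least \<open>r_q\<close>, with equality only for the
  expansion of \<open>r_q\<close> itself. Two expansions with a common digit satisfy
  \<open>x\<^sub>0 - x'\<^sub>0 = x\<^sub>0 x'\<^sub>0 (x\<^sub>1 - x'\<^sub>1)\<close>, and this contracts over two steps, which gives convergence of
  the continued fractions and uniqueness of the point with a given coding.
\<close>

section \<open>Monotonicity of negative reciprocals, and shifts of digit sequences\<close>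

lemma neg_inverse_mono: "0 < (a::real) \<Longrightarrow> a \<le> b \<Longrightarrow> - 1 / a \<le> - 1 / b"
  by (simp add: frac_le)

lemma neg_inverse_strict_mono: "0 < (a::real) \<Longrightarrow> a < b \<Longrightarrow> - 1 / a < - 1 / b"
  by (simp add: frac_less2)

lemma shift_pow: "(shift ^^ n) b i = b (n + i)"
  by (induction n arbitrary: i) (auto simp: shift_def)

lemma map_upt_shift: "map b [0..<Suc n] = b 0 # map (shift b) [0..<n]"
proof -
  have "map b [0..<Suc n] = b 0 # map b (map Suc [0..<n])"
    by (simp add: upt_conv_Cons map_Suc_upt del: upt_Suc)
  then show ?thesis by (simp add: shift_def comp_def)
qed

locale even_hecke =
  fixes q :: nat
  assumes q_ge_4: "q \<ge> 4" and even_q: "even q"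
begin

abbreviation lam :: real where "lam \<equiv> lambda_q q"

abbreviation h :: nat where "h \<equiv> h_q q"

section \<open>Bounds on \<open>lam\<close> and the finite orbit of 1 under \<open>S\<close>\<close>

lemma q_eq: "q = 2 * h + 2"
  using q_ge_4 even_q by (auto simp: h_q_def elim!: evenE)

lemma h_pos: "1 \<le> h"
  using q_ge_4 by (auto simp: h_q_def)

text \<open>From \<open>q >= 4\<close> comes \<open>lam >= sqrt 2\<close>. This is the quantitative
  input of \<open>digit_step_den\<close>.\<close>

lemma lam_sq: "2 \<le> lam * lam"
proof -
  have "cos (pi / 4) \<le> cos (pi / real q)"
    using q_ge_4 by (intro cos_monotone_0_pi_le) (auto simp: field_simps)
  then have "sqrt 2 \<le> lam"
    by (simp add: lambda_q_def cos_45)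
  then have "sqrt 2 * sqrt 2 \<le> lam * lam"
    by (intro mult_mono) (auto intro: order_trans[of 0 "sqrt 2"])
  then show ?thesis by simp
qed

lemma lam_less_2: "lam < 2"
proof -
  have "cos (pi / real q) < cos 0"
    using q_ge_4 by (intro cos_monotone_0_pi) (auto simp: field_simps)
  then show ?thesis by (simp add: lambda_q_def)
qed

lemma lam_gt_1: "1 < lam"
proof -
  have "cos (pi / 3) < cos (pi / real q)"
    using q_ge_4 by (intro cos_monotone_0_pi) (auto simp: field_simps)
  then show ?thesis
    by (simp add: lambda_q_def cos_60)
qed

text \<open>The orbit of 1 under \<open>S t = -1 / (lam + t)\<close>; it passes through \<open>r_q\<close> after \<open>h\<close> steps
  and reaches -1 one step later.\<close>

definition s :: "nat \<Rightarrow> real" where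
  "s j = - sin ((2 * real j - 1) * pi / (2 * real q)) / sin ((2 * real j + 1) * pi / (2 * real q))"

lemma sin_pos_aux: "j \<le> Suc h \<Longrightarrow> 0 < sin ((2 * real j + 1) * pi / (2 * real q))"
proof (rule sin_gt_zero)
  assume "j \<le> Suc h"
  then have "2 * j + 1 < 2 * q" "0 < q" using q_eq h_pos by linarith+
  then have "2 * real j + 1 < 2 * real q" "0 < real q" by linarith+
  then show "0 < (2 * real j + 1) * pi / (2 * real q)"
    and "(2 * real j + 1) * pi / (2 * real q) < pi"
    using mult_strict_right_mono[of "2 * real j + 1" "2 * real q" pi]
    by (auto simp: divide_less_eq mult_ac)
qed

lemma s_0: "s 0 = 1"
proof -
  have "sin (pi / (2 * real q)) \<noteq> 0"
    using sin_pos_aux[of 0] by auto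
  then show ?thesis by (simp add: s_def)
qed

text \<open>With \<open>a\<close> the angle in the denominator of \<open>s j\<close> and
  \<open>t = pi / q\<close>, this is the identity
  \<open>sin (a + t) + sin (a - t) = 2 * cos t * sin a\<close>.\<close>

lemma s_Suc:
  assumes "j \<le> h"
  shows "s (Suc j) = - 1 / (lam + s j)"
proof -
  define t where "t = pi / real q"
  define a where "a = (2 * real j + 1) * pi / (2 * real q)"
  have q0: "real q \<noteq> 0" using q_ge_4 by simp
  have e1: "(2 * real j - 1) * pi / (2 * real q) = a - t"
    and e2: "(2 * real (Suc j) - 1) * pi / (2 * real q) = a"
    and e3: "(2 * real (Suc j) + 1) * pi / (2 * real q) = a + t"
    using q0 by (simp_all add: a_def t_def field_simps)
  have pos: "0 < sin a" "0 < sin (a + t)"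
    using sin_pos_aux[of j] sin_pos_aux[of "Suc j"] assms e3 by (simp_all add: a_def)
  have "lam * sin a - sin (a - t) = sin (a + t)"
    by (simp add: lambda_q_def t_def[symmetric] sin_add sin_diff)
  moreover have "s j = - sin (a - t) / sin a"
    unfolding s_def e1 a_def ..
  ultimately have "lam + s j = sin (a + t) / sin a"
    using pos by (simp add: field_simps)
  moreover have "s (Suc j) = - sin a / sin (a + t)"
    unfolding s_def e2 e3 ..
  ultimately show ?thesis using pos by simp
qed

text \<open>At this index the two angles lie symmetrically about \<open>pi / 2\<close>, so their
  sines agree.\<close>

lemma s_Suc_h: "s (Suc h) = - 1"
proof -
  define a where "a = pi / (2 * real q)"
  have q0: "real q \<noteq> 0" using q_ge_4 by simp
  have hq: "2 * real (Suc h) = real q" using arg_cong[OF q_eq, of real] by simp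
  have "(2 * real (Suc h) - 1) * pi / (2 * real q) = pi / 2 - a"
    and "(2 * real (Suc h) + 1) * pi / (2 * real q) = pi / 2 + a"
    unfolding hq using q0 by (simp_all add: a_def field_simps)
  moreover have "sin (pi / 2 + a) \<noteq> 0"
    using calculation sin_pos_aux[of "Suc h"] by simp
  ultimately show ?thesis
    unfolding s_def by (simp add: sin_add sin_diff)
qed

text \<open>For \<open>j <= h\<close> both angles lie between \<open>-pi / 2\<close> and
  \<open>pi / 2\<close>, where the sine is strictly increasing; the larger one is within range
  because \<open>2 * h + 1 <= q\<close>.\<close>

lemma s_gt_m1:
  assumes "j \<le> h"
  shows "- 1 < s j"
proof -
  have q0: "0 < real q" using q_ge_4 by simp
  have "2 * j + 1 \<le> q" using assms q_eq by linarith
  then have "2 * real j + 1 \<le> real q" by linarith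
  then have u: "(2 * real j + 1) * pi / (2 * real q) \<le> pi / 2"
    using q0 mult_right_mono[of "2 * real j + 1" "real q" pi] by (simp add: divide_le_eq mult_ac)
  have "- real q * pi \<le> (2 * real j - 1) * pi"
    using q_ge_4 by (intro mult_right_mono) auto
  then have l: "- (pi / 2) \<le> (2 * real j - 1) * pi / (2 * real q)"
    using q0 by (simp add: field_simps)
  have "(2 * real j - 1) * pi / (2 * real q) < (2 * real j + 1) * pi / (2 * real q)"
    using q0 by (intro divide_strict_right_mono mult_strict_right_mono) auto
  then have "sin ((2 * real j - 1) * pi / (2 * real q)) < sin ((2 * real j + 1) * pi / (2 * real q))"
    using l u by (intro sin_monotone_2pi)
  then show ?thesis
    using sin_pos_aux[of j] assms by (simp add: s_def field_simps)
qed

lemma s_ge_m1: "j \<le> Suc h \<Longrightarrow> - 1 \<le> s j"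
  using s_gt_m1[of j] s_Suc_h by (cases "j = Suc h") auto

lemma lam_s_pos: "j \<le> Suc h \<Longrightarrow> 0 < lam + s j"
  using s_ge_m1[of j] lam_gt_1 by linarith

text \<open>Solved backwards from \<open>s (Suc h) = -1\<close>.\<close>

lemma s_h: "s h = 1 - lam"
  using s_Suc[of h] s_Suc_h lam_s_pos[of h] by (simp add: field_simps)

lemma s_1: "s 1 = - 1 / (lam + 1)"
  using s_Suc[of 0] s_0 by simp

text \<open>\<open>S\<close> is increasing, so the inequality \<open>s 1 < s 0\<close> propagates
  along the orbit.\<close>

lemma s_decr: "j \<le> h \<Longrightarrow> s (Suc j) < s j"
proof (induction j)
  case 0
  have "- 1 / (lam + 1) < 0" using lam_gt_1 by (intro divide_neg_pos) auto
  then show ?case using s_0 s_1 by (simp del: divide_minus_left)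
next
  case (Suc j)
  then have "- 1 / (lam + s (Suc j)) < - 1 / (lam + s j)"
    using lam_s_pos[of "Suc j"] by (intro neg_inverse_strict_mono) auto
  then show ?case using s_Suc[of j] s_Suc[of "Suc j"] Suc.prems by simp
qed

lemma s_strict_antimono: "i < j \<Longrightarrow> j \<le> Suc h \<Longrightarrow> s j < s i"
proof (induction j)
  case (Suc j)
  then show ?case using s_decr[of j] by (cases "i = j") auto
qed simp

lemma s_neg: "1 \<le> j \<Longrightarrow> j \<le> Suc h \<Longrightarrow> s j < 0"
proof -
  assume j: "1 \<le> j" "j \<le> Suc h"
  have "s 1 < 0" using s_1 lam_gt_1 by simp
  then show ?thesis using s_strict_antimono[of 1 j] j by (cases "j = 1") auto
qed

section \<open>Dual regularity as a condition on consecutive digits\<close>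

text \<open>The lists in \<open>A_dreg\<close> run backwards, so in the order of the sequence a
  forbidden block is a digit of sign \<open>e\<close> at \<open>l\<close> followed by
  \<open>h\<close> digits \<open>e\<close>. The block of \<open>h + 1\<close> equal signs is the
  case \<open>m = 1\<close>.\<close>

lemma A_dreg_iff:
  "b \<in> A_dreg q \<longleftrightarrow> (\<forall>i. b i \<noteq> 0) \<and>
     (\<forall>l. \<forall>e \<in> {1, - 1}. 1 \<le> e * b l \<longrightarrow> \<not> (\<forall>k<h. b (Suc (l + k)) = e))"
proof -
  have blk: "map b (rev [l..<Suc L]) = replicate h e @ [m] \<longleftrightarrow>
      L = l + h \<and> b l = m \<and> (\<forall>k<h. b (Suc (l + k)) = e)" if "l < L" for l L e m
  proof -
    have "map b (rev [l..<Suc L]) = replicate h e @ [m] \<longleftrightarrow>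
        map b [l..<Suc L] = m # replicate h e"
      by (metis rev_append rev_map rev_replicate rev_rev_ident rev.simps append.simps)
    also have "\<dots> \<longleftrightarrow> b l = m \<and> map b [Suc l..<Suc L] = replicate h e"
      using that by (simp add: upt_conv_Cons del: upt_Suc)
    also have "map b [Suc l..<Suc L] = replicate h e \<longleftrightarrow>
        L - l = h \<and> (\<forall>k<h. b (Suc (l + k)) = e)"
      by (simp add: list_eq_iff_nth_eq del: upt_Suc cong: conj_cong)
    finally have "map b (rev [l..<Suc L]) = replicate h e @ [m] \<longleftrightarrow>
        b l = m \<and> L - l = h \<and> (\<forall>k<h. b (Suc (l + k)) = e)" .
    moreover have "L - l = h \<longleftrightarrow> L = l + h" using that by auto
    ultimately show ?thesis by blast
  qed
  have fb: "forbidden_blocks q = {replicate h e @ [e * m] | e m. e \<in> {1, - 1} \<and> 1 \<le> m}"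
  proof -
    have "\<exists>e' m. replicate (h + 1) e = replicate h e' @ [e' * m] \<and> e' \<in> {1, - 1} \<and> 1 \<le> m"
      if "e \<in> {1, - 1::int}" for e
      using that by (intro exI[of _ e] exI[of _ 1]) (auto simp: replicate_append_same)
    then show ?thesis unfolding forbidden_blocks_def by blast
  qed
  show ?thesis
  proof (intro iffI conjI allI ballI impI notI)
    fix i assume "b \<in> A_dreg q" "b i = 0" then show False by (simp add: A_dreg_def)
  next
    fix l e assume b: "b \<in> A_dreg q" and e: "e \<in> {1, - 1::int}" "1 \<le> e * b l"
      and k: "\<forall>k<h. b (Suc (l + k)) = e"
    \<comment> \<open>The multiplier is \<open>m = e * b l\<close>, since
      \<open>e * e = 1\<close>.\<close>
    have "map b (rev [l..<Suc (l + h)]) = replicate h e @ [e * (e * b l)]"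
      using blk[of l "l + h" e "e * (e * b l)"] h_pos k e by auto
    then have "map b (rev [l..<Suc (l + h)]) \<in> forbidden_blocks q"
      using e unfolding fb by blast
    then show False using b h_pos unfolding A_dreg_def by force
  next
    assume a: "(\<forall>i. b i \<noteq> 0) \<and>
     (\<forall>l. \<forall>e \<in> {1, - 1}. 1 \<le> e * b l \<longrightarrow> \<not> (\<forall>k<h. b (Suc (l + k)) = e))"
    have False if "l < L" "map b (rev [l..<Suc L]) \<in> forbidden_blocks q" for l L
    proof -
      from that obtain e m where em: "map b (rev [l..<Suc L]) = replicate h e @ [e * m]"
        "e \<in> {1, - 1}" "1 \<le> m" unfolding fb by blast
      then have "b l = e * m" "\<forall>k<h. b (Suc (l + k)) = e" using blk[OF that(1)] by blast+
      moreover have "1 \<le> e * b l" using em(2,3) \<open>b l = e * m\<close> by auto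
      ultimately show False using a em(2) by blast
    qed
    then show "b \<in> A_dreg q" using a unfolding A_dreg_def by blast
  qed
qed

lemma A_nz: "b \<in> A_dreg q \<Longrightarrow> b i \<noteq> 0"
  by (simp add: A_dreg_iff)

lemma A_shift: "b \<in> A_dreg q \<Longrightarrow> shift b \<in> A_dreg q"
  unfolding A_dreg_iff shift_def by (metis add_Suc)

lemma A_shift_pow: "b \<in> A_dreg q \<Longrightarrow> (shift ^^ n) b \<in> A_dreg q"
  by (induction n) (auto simp: A_shift)

lemma A_neg: "b \<in> A_dreg q \<Longrightarrow> (\<lambda>i. - b i) \<in> A_dreg q"
  unfolding A_dreg_iff by (fastforce simp: minus_equation_iff)

lemma A_no_ones: "b \<in> A_dreg q \<Longrightarrow> 0 < b 0 \<Longrightarrow> \<not> (\<forall>i<h. shift b i = 1)"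
  using A_dreg_iff[of b] by (auto simp: shift_def dest!: spec[of _ 0])

lemma A_no_ones_start: "b \<in> A_dreg q \<Longrightarrow> \<not> (\<forall>i<Suc h. b i = 1)"
  using A_no_ones[of b] by (force simp: shift_def)

section \<open>Bounds on the convergents of dual regular sequences\<close>

lemma convergent_cf_0: "convergent_cf q b 0 = 0"
  by (simp add: convergent_cf_def)

lemma convergent_cf_Suc:
  "convergent_cf q b (Suc n) = - 1 / (b 0 * lam + convergent_cf q (shift b) n)"
  unfolding convergent_cf_def map_upt_shift by simp

lemma convergent_cf_neg: "convergent_cf q (\<lambda>i. - b i) n = - convergent_cf q b n"
proof (induction n arbitrary: b)
  case 0
  then show ?case by (simp add: convergent_cf_0)
next
  case (Suc n)
  have "shift (\<lambda>i. - b i) = (\<lambda>i. - shift b i)" by (simp add: shift_def)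
  then show ?case
    using Suc[of "shift b"] by (simp add: convergent_cf_Suc minus_divide_right)
qed

text \<open>Since \<open>s j\<close> arises from 1 by prepending \<open>j\<close> ones and
  \<open>S\<close> is increasing, only \<open>j\<close> leading ones could push the value below
  \<open>s j\<close>. The induction varies \<open>j\<close>: a leading 1 lowers it by one, while
  after a digit at least 2 regularity allows a restart at \<open>j = h\<close>.\<close>

lemma cf_lower:
  assumes "b \<in> A_dreg q" "1 \<le> j" "j \<le> Suc h" "\<not> (\<forall>i<j. b i = 1)"
  shows "s j \<le> convergent_cf q b n"
  using assms
proof (induction n arbitrary: b j)
  case 0
  then show ?case using s_neg[of j] by (simp add: convergent_cf_0)
next
  case (Suc n)
  let ?x = "convergent_cf q (shift b) n"
  have sA: "shift b \<in> A_dreg q" using Suc.prems A_shift by blast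
  consider "b 0 < 0" | "b 0 = 1" | "2 \<le> b 0" using A_nz[OF Suc.prems(1), of 0] by linarith
  then show ?case
  proof cases
    case 1
    \<comment> \<open>The upper bound 1 for the tail is the induction hypothesis for the negated
      tail, with \<open>s (Suc h) = -1\<close>.\<close>
    have "s (Suc h) \<le> convergent_cf q (\<lambda>i. - shift b i) n"
      using A_neg[OF sA] A_no_ones_start[OF A_neg[OF sA]] by (intro Suc.IH) auto
    then have "?x \<le> 1" by (simp add: convergent_cf_neg s_Suc_h)
    moreover have "b 0 * lam \<le> (- 1) * lam" using 1 lam_gt_1 by (intro mult_right_mono) auto
    ultimately have "0 < - 1 / (b 0 * lam + ?x)"
      using lam_gt_1 by (intro divide_neg_neg) auto
    then show ?thesis using s_neg[OF Suc.prems(2,3)] unfolding convergent_cf_Suc by linarith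
  next
    case 2
    \<comment> \<open>A digit other than 1 occurs before index \<open>j\<close> but not at 0, so
      \<open>j - 1\<close> is still at least 1.\<close>
    with Suc.prems obtain i where i: "i < j" "b i \<noteq> 1" by blast
    with 2 obtain i' where i': "i = Suc i'" by (cases i) auto
    then have "s (j - 1) \<le> ?x"
      using i Suc.prems sA by (intro Suc.IH) (auto simp: shift_def intro!: exI[of _ i'])
    then have "- 1 / (lam + s (j - 1)) \<le> - 1 / (lam + ?x)"
      using Suc.prems lam_s_pos[of "j - 1"] by (intro neg_inverse_mono) auto
    then show ?thesis
      using s_Suc[of "j - 1"] Suc.prems 2 by (simp add: convergent_cf_Suc)
  next
    case 3
    have "s h \<le> ?x"
      using 3 Suc.prems A_no_ones h_pos sA by (intro Suc.IH) auto
    moreover have "2 * lam \<le> b 0 * lam" using 3 lam_gt_1 by (intro mult_right_mono) auto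
    ultimately have "lam + 1 \<le> b 0 * lam + ?x" unfolding s_h by linarith
    then have "- 1 / (lam + 1) \<le> - 1 / (b 0 * lam + ?x)"
      using lam_gt_1 by (intro neg_inverse_mono) auto
    moreover have "s j \<le> s 1" using Suc.prems s_strict_antimono[of 1 j] by (cases "j = 1") auto
    ultimately show ?thesis using s_1 by (simp add: convergent_cf_Suc)
  qed
qed

lemma cf_ge_m1: "b \<in> A_dreg q \<Longrightarrow> - 1 \<le> convergent_cf q b n"
  using cf_lower[of b "Suc h" n] A_no_ones_start[of b] s_Suc_h by auto

lemma cf_bounded: "b \<in> A_dreg q \<Longrightarrow> \<bar>convergent_cf q b n\<bar> \<le> 1"
  using cf_ge_m1[of b n] cf_ge_m1[OF A_neg, of b n] by (simp add: convergent_cf_neg)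

lemma cf_after_pos: "b \<in> A_dreg q \<Longrightarrow> 0 < b 0 \<Longrightarrow> 1 - lam \<le> convergent_cf q (shift b) n"
  using cf_lower[of "shift b" h n] A_no_ones[of b] A_shift[of b] s_h h_pos by auto

lemma cf_after_neg: "b \<in> A_dreg q \<Longrightarrow> b 0 < 0 \<Longrightarrow> convergent_cf q (shift b) n \<le> lam - 1"
  using cf_after_pos[OF A_neg, of b n] convergent_cf_neg[of "shift b" n]
  by (simp add: shift_def)

section \<open>Single expansion steps and contraction along orbits with common digits\<close>

text \<open>The bounds on \<open>y\<close> are closed, so they survive limits and neighbouring
  digits share end points. The relation covers convergents, infinite fractions and orbits of
  \<open>f_dual\<close> alike.\<close>

definition digit_step :: "int \<Rightarrow> real \<Rightarrow> real \<Rightarrow> bool" where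
  "digit_step d x y \<longleftrightarrow> d \<noteq> 0 \<and> x = - 1 / (d * lam + y) \<and> \<bar>y\<bar> \<le> 1 \<and>
     (0 < d \<longrightarrow> 1 - lam \<le> y) \<and> (d < 0 \<longrightarrow> y \<le> lam - 1)"

lemma digit_step_neg: "digit_step (- d) (- x) (- y) \<longleftrightarrow> digit_step d x y"
proof -
  have "- x = - 1 / (of_int (- d) * lam + - y) \<longleftrightarrow> x = - 1 / (d * lam + y)"
  proof -
    have "of_int (- d) * lam + - y = - (d * lam + y)" by simp
    then show ?thesis by (metis minus_divide_right minus_minus)
  qed
  then show ?thesis unfolding digit_step_def by auto
qed

lemma digit_step_den:
  assumes "digit_step d x y"
  shows "1 \<le> \<bar>d * lam + y\<bar>" and "\<bar>y\<bar> \<le> (lam - 1) * \<bar>d * lam + y\<bar>"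
proof -
  have *: "1 \<le> d * lam + y \<and> \<bar>y\<bar> \<le> (lam - 1) * (d * lam + y)" if "digit_step d x y" "0 < d" for d x y
  proof -
    have 1: "1 * lam \<le> d * lam" using that lam_gt_1 by (intro mult_right_mono) auto
    have y: "\<bar>y\<bar> \<le> 1" "1 - lam \<le> y" using that by (auto simp: digit_step_def)
    have 2: "1 \<le> d * lam + y" using 1 y by linarith
    have "(lam - 1) * (lam + y) \<le> (lam - 1) * (d * lam + y)"
      using 1 lam_gt_1 by (intro mult_left_mono) auto
    moreover have "\<bar>y\<bar> \<le> (lam - 1) * (lam + y)"
    proof (cases "0 \<le> y")
      case True
      \<comment> \<open>With \<open>lam * lam >= 2\<close> this gives
        \<open>y * (2 - lam) <= lam * lam - lam\<close>, which is the claim rearranged.\<close>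
      have "y * (2 - lam) \<le> 1 * (2 - lam)" using y lam_less_2 by (intro mult_right_mono) auto
      then show ?thesis using True lam_sq by (simp add: algebra_simps)
    next
      case False
      have "\<bar>y\<bar> \<le> (lam - 1) * 1" using False y by simp
      also have "\<dots> \<le> (lam - 1) * (lam + y)"
        using y lam_gt_1 by (intro mult_left_mono) auto
      finally show ?thesis .
    qed
    ultimately show ?thesis using 2 by linarith
  qed
  have "1 \<le> \<bar>d * lam + y\<bar> \<and> \<bar>y\<bar> \<le> (lam - 1) * \<bar>d * lam + y\<bar>"
  proof (cases "0 < d")
    case True
    then show ?thesis using *[OF assms True] by simp
  next
    case False
    then have "0 < - d" using assms by (auto simp: digit_step_def)
    moreover have "digit_step (- d) (- x) (- y)" using assms digit_step_neg by blast
    ultimately have "1 \<le> of_int (- d) * lam + - y \<and> \<bar>- y\<bar> \<le> (lam - 1) * (of_int (- d) * lam + - y)"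
      using * by blast
    moreover from calculation have "\<bar>d * lam + y\<bar> = of_int (- d) * lam + - y" by simp
    ultimately show ?thesis by simp
  qed
  then show "1 \<le> \<bar>d * lam + y\<bar>" and "\<bar>y\<bar> \<le> (lam - 1) * \<bar>d * lam + y\<bar>" by auto
qed

text \<open>Products of two consecutive values are the factors of the two-step contraction;
  \<open>lam < 2\<close> makes the bound smaller than 1.\<close>

lemma digit_step_prod:
  assumes "digit_step d x y"
  shows "\<bar>x * y\<bar> \<le> lam - 1"
proof -
  have "\<bar>x * y\<bar> = \<bar>y\<bar> / \<bar>d * lam + y\<bar>"
    using assms by (simp add: digit_step_def abs_mult)
  then show ?thesis
    using digit_step_den[OF assms] lam_gt_1 by (simp add: divide_le_eq)
qed

lemma digit_step_diff:
  assumes "digit_step d x y" "digit_step d x' y'"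
  shows "x - x' = x * x' * (y - y')"
proof -
  define A B where "A = d * lam + y" and "B = d * lam + y'"
  have "A \<noteq> 0" "B \<noteq> 0"
    using digit_step_den(1)[OF assms(1)] digit_step_den(1)[OF assms(2)]
    by (auto simp: A_def B_def)
  moreover have x: "x = - 1 / A" "x' = - 1 / B" and y: "y - y' = A - B"
    using assms by (auto simp: digit_step_def A_def B_def)
  ultimately show ?thesis unfolding x y by (simp add: field_simps)
qed

lemma digit_step_nz: "digit_step d x y \<Longrightarrow> x \<noteq> 0"
  using digit_step_den(1)[of d x y] by (auto simp: digit_step_def)

text \<open>For \<open>N = 0\<close> only the bound on \<open>x 0\<close> remains; it starts the
  induction in \<open>orbit_dist\<close>.\<close>

definition orbit :: "nat \<Rightarrow> (nat \<Rightarrow> int) \<Rightarrow> (nat \<Rightarrow> real) \<Rightarrow> bool" where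
  "orbit N b x \<longleftrightarrow> \<bar>x 0\<bar> \<le> 1 \<and> (\<forall>i<N. digit_step (b i) (x i) (x (Suc i)))"

lemma orbit_mono: "orbit N b x \<Longrightarrow> M \<le> N \<Longrightarrow> orbit M b x"
  by (auto simp: orbit_def)

lemma orbit_Suc: "orbit (Suc N) b x \<Longrightarrow> orbit N (shift b) (\<lambda>i. x (Suc i))"
  by (auto simp: orbit_def shift_def digit_step_def)

text \<open>A single step need not contract: the derivative of a branch is \<open>x\<^sup>2\<close>, which is 1 at the end
  points. Over two steps the factor \<open>(x\<^sub>0 x\<^sub>1) (x'\<^sub>0 x'\<^sub>1)\<close> is at most \<open>(lam - 1)\<^sup>2\<close>.\<close>

lemma orbit_dist:
  "orbit (2 * k) b x \<Longrightarrow> orbit (2 * k) b y \<Longrightarrow> \<bar>x 0 - y 0\<bar> \<le> 2 * ((lam - 1)\<^sup>2) ^ k"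
proof (induction k arbitrary: b x y)
  case 0
  then show ?case by (simp add: orbit_def)
next
  case (Suc k)
  have d: "digit_step (b 0) (x 0) (x 1)" "digit_step (b 1) (x 1) (x 2)"
    "digit_step (b 0) (y 0) (y 1)" "digit_step (b 1) (y 1) (y 2)"
    using Suc.prems by (auto simp: orbit_def numeral_2_eq_2)
  have "orbit (2 * k) (shift (shift b)) (\<lambda>i. x (Suc (Suc i)))"
    "orbit (2 * k) (shift (shift b)) (\<lambda>i. y (Suc (Suc i)))"
    using Suc.prems orbit_Suc[OF orbit_Suc, of "2 * k" b] by simp_all
  then have IH: "\<bar>x 2 - y 2\<bar> \<le> 2 * ((lam - 1)\<^sup>2) ^ k"
    using Suc.IH[of "shift (shift b)" "\<lambda>i. x (Suc (Suc i))" "\<lambda>i. y (Suc (Suc i))"]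
    by (simp add: numeral_2_eq_2)
  have "x 0 - y 0 = ((x 0 * x 1) * (y 0 * y 1)) * (x 2 - y 2)"
    using digit_step_diff[OF d(1,3)] digit_step_diff[OF d(2,4)] by simp
  then have "\<bar>x 0 - y 0\<bar> = (\<bar>x 0 * x 1\<bar> * \<bar>y 0 * y 1\<bar>) * \<bar>x 2 - y 2\<bar>"
    by (simp add: abs_mult)
  also have "\<dots> \<le> ((lam - 1) * (lam - 1)) * (2 * ((lam - 1)\<^sup>2) ^ k)"
    using digit_step_prod[OF d(1)] digit_step_prod[OF d(3)] IH lam_gt_1
    by (intro mult_mono) auto
  finally show ?case by (simp add: power2_eq_square algebra_simps)
qed

lemma contraction_tendsto_0: "(\<lambda>k. 2 * ((lam - 1)\<^sup>2) ^ k) \<longlonglongrightarrow> 0"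
proof -
  have "(lam - 1)\<^sup>2 < 1" using lam_gt_1 lam_less_2 by (simp add: power2_less_1_iff abs_square_less_1)
  then have "(\<lambda>k. 2 * ((lam - 1)\<^sup>2) ^ k) \<longlonglongrightarrow> 2 * 0"
    by (intro tendsto_mult tendsto_const LIMSEQ_realpow_zero) auto
  then show ?thesis by simp
qed

lemma orbit_unique:
  assumes "\<And>N. orbit N b x" "\<And>N. orbit N b y"
  shows "x 0 = y 0"
proof -
  have "\<bar>x 0 - y 0\<bar> \<le> 0"
    by (rule LIMSEQ_le_const[OF contraction_tendsto_0]) (use orbit_dist assms in blast)
  then show ?thesis by simp
qed

section \<open>Convergence of the continued fractions and properties of the limits\<close>

lemma cf_digit_step:
  "b \<in> A_dreg q \<Longrightarrow> digit_step (b 0) (convergent_cf q b (Suc n)) (convergent_cf q (shift b) n)"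
  using A_nz cf_bounded A_shift cf_after_pos cf_after_neg
  by (simp add: digit_step_def convergent_cf_Suc)

text \<open>The tails of a convergent are convergents of the shifted sequences, each shorter by one.
  So \<open>orbit_dist\<close> compares a convergent with any orbit that has the same leading
  digits.\<close>

lemma cf_orbit:
  assumes "b \<in> A_dreg q"
  shows "orbit n b (\<lambda>i. convergent_cf q ((shift ^^ i) b) (n - i))"
proof -
  have "digit_step (b i) (convergent_cf q ((shift ^^ i) b) (n - i))
      (convergent_cf q ((shift ^^ Suc i) b) (n - Suc i))" if "i < n" for i
    using cf_digit_step[OF A_shift_pow[OF assms, of i], of "n - Suc i"] that
    by (simp add: shift_pow Suc_diff_Suc)
  then show ?thesis using cf_bounded[OF assms] by (simp add: orbit_def)
qed

lemma orbit_cf_tendsto: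
  assumes "b \<in> A_dreg q" "\<And>N. orbit N b x"
  shows "convergent_cf q b \<longlonglongrightarrow> x 0"
proof (rule LIMSEQ_I)
  fix e :: real assume "0 < e"
  then obtain k where k: "2 * ((lam - 1)\<^sup>2) ^ k < e"
    using LIMSEQ_D[OF contraction_tendsto_0, of e] by auto
  have "norm (convergent_cf q b n - x 0) < e" if "2 * k \<le> n" for n
    using orbit_dist[OF orbit_mono[OF cf_orbit[OF assms(1)] that] assms(2)] k by simp
  then show "\<exists>no. \<forall>n\<ge>no. norm (convergent_cf q b n - x 0) < e" by blast
qed

lemma cf_convergent:
  assumes "b \<in> A_dreg q"
  shows "convergent (convergent_cf q b)"
proof -
  have "Cauchy (convergent_cf q b)"
  proof (rule CauchyI)
    fix e :: real assume "0 < e"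
    then obtain k where k: "2 * ((lam - 1)\<^sup>2) ^ k < e"
      using LIMSEQ_D[OF contraction_tendsto_0, of e] by auto
    have "norm (convergent_cf q b m - convergent_cf q b n) < e" if "2 * k \<le> m" "2 * k \<le> n" for m n
      using orbit_dist[OF orbit_mono[OF cf_orbit[OF assms] that(1)]
          orbit_mono[OF cf_orbit[OF assms] that(2)]] k by simp
    then show "\<exists>M. \<forall>m\<ge>M. \<forall>n\<ge>M. norm (convergent_cf q b m - convergent_cf q b n) < e" by blast
  qed
  then show ?thesis by (simp add: Cauchy_convergent_iff)
qed

lemma inf_cf_tendsto: "b \<in> A_dreg q \<Longrightarrow> convergent_cf q b \<longlonglongrightarrow> inf_cf q b"
  using cf_convergent by (simp add: inf_cf_def convergent_LIMSEQ_iff)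

lemma inf_cf_neg: "b \<in> A_dreg q \<Longrightarrow> inf_cf q (\<lambda>i. - b i) = - inf_cf q b"
  using LIMSEQ_unique[OF inf_cf_tendsto[OF A_neg, unfolded convergent_cf_neg]
      tendsto_minus[OF inf_cf_tendsto]] .

lemma inf_cf_lower:
  assumes "b \<in> A_dreg q" "1 \<le> j" "j \<le> Suc h" "\<not> (\<forall>i<j. b i = 1)"
  shows "s j \<le> inf_cf q b"
  using LIMSEQ_le_const[OF inf_cf_tendsto[OF assms(1)]] cf_lower[OF assms] by blast

lemma inf_cf_bounded: "b \<in> A_dreg q \<Longrightarrow> \<bar>inf_cf q b\<bar> \<le> 1"
  using LIMSEQ_le_const2[OF tendsto_rabs[OF inf_cf_tendsto]] cf_bounded by blast

text \<open>The recursion and the closed bounds on the tail pass from the convergents to the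
  limit.\<close>

lemma inf_cf_digit_step:
  assumes "b \<in> A_dreg q"
  shows "digit_step (b 0) (inf_cf q b) (inf_cf q (shift b))"
proof -
  note sA = A_shift[OF assms]
  note lim = inf_cf_tendsto[OF sA]
  have pos: "1 - lam \<le> inf_cf q (shift b)" if "0 < b 0"
    using LIMSEQ_le_const[OF lim] cf_after_pos[OF assms that] by blast
  have neg: "inf_cf q (shift b) \<le> lam - 1" if "b 0 < 0"
    using LIMSEQ_le_const2[OF lim] cf_after_neg[OF assms that] by blast
  have bd: "\<bar>inf_cf q (shift b)\<bar> \<le> 1" using inf_cf_bounded[OF sA] .
  \<comment> \<open>Stated for the explicit quotient, whose equation is trivial, to learn that the
    limiting denominator is nonzero before taking the limit of the quotient.\<close>
  have "digit_step (b 0) (- 1 / (b 0 * lam + inf_cf q (shift b))) (inf_cf q (shift b))"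
    using A_nz[OF assms] pos neg bd by (simp add: digit_step_def)
  then have "b 0 * lam + inf_cf q (shift b) \<noteq> 0" using digit_step_den(1) by force
  then have "(\<lambda>n. - 1 / (b 0 * lam + convergent_cf q (shift b) n)) \<longlonglongrightarrow>
      - 1 / (b 0 * lam + inf_cf q (shift b))"
    by (intro tendsto_intros lim)
  then have "(\<lambda>n. convergent_cf q b (Suc n)) \<longlonglongrightarrow> - 1 / (b 0 * lam + inf_cf q (shift b))"
    by (simp add: convergent_cf_Suc)
  then have "inf_cf q b = - 1 / (b 0 * lam + inf_cf q (shift b))"
    using LIMSEQ_unique LIMSEQ_Suc[OF inf_cf_tendsto[OF assms]] by blast
  then show ?thesis
    using A_nz[OF assms] pos neg bd by (simp add: digit_step_def)
qed

lemma inf_cf_orbit_step: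
  assumes "b \<in> A_dreg q"
  shows "digit_step (b i) (inf_cf q ((shift ^^ i) b)) (inf_cf q ((shift ^^ Suc i) b))"
  using inf_cf_digit_step[OF A_shift_pow[OF assms, of i]] by (simp add: shift_pow)

lemma cf_defined: "b \<in> A_dreg q \<Longrightarrow> fin_cf_defined lam (map b [0..<n])"
proof (induction n arbitrary: b)
  case (Suc n)
  have "b 0 * lam + convergent_cf q (shift b) n \<noteq> 0"
    using digit_step_den(1)[OF cf_digit_step[OF Suc.prems, of n]] by auto
  then show ?case
    unfolding map_upt_shift using Suc.IH[OF A_shift[OF Suc.prems]] by (simp add: convergent_cf_def)
qed simp

section \<open>The expansions that attain the bounds, and the expansion of
  \<open>r_q\<close>\<close>

text \<open>Equality in \<open>inf_cf_lower\<close> forces the digits one at a time; after the digit 2 the value is \<open>r_q\<close> again,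
  which produces the periodic sequence.\<close>

lemma inf_cf_eq_s:
  assumes b: "b \<in> A_dreg q" and j: "1 \<le> j" "j \<le> Suc h" "\<not> (\<forall>i<j. b i = 1)"
    and eq: "inf_cf q b = s j"
  shows "(if j = 1 then b 0 = 2 \<and> inf_cf q (shift b) = s h \<and> \<not> (\<forall>i<h. shift b i = 1)
    else b 0 = 1 \<and> inf_cf q (shift b) = s (j - 1) \<and> \<not> (\<forall>i<j - 1. shift b i = 1))"
proof -
  let ?y = "inf_cf q (shift b)"
  note st = inf_cf_digit_step[OF b]
  have x: "inf_cf q b = - 1 / (b 0 * lam + ?y)" using st by (simp add: digit_step_def)
  consider "b 0 < 0" | "b 0 = 1" | "2 \<le> b 0" using A_nz[OF b, of 0] by linarith
  then show ?thesis
  proof cases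
    case 1
    have "b 0 * lam \<le> (- 1) * lam" using 1 lam_gt_1 by (intro mult_right_mono) auto
    moreover have "?y \<le> lam - 1" using st 1 by (simp add: digit_step_def)
    ultimately have "0 < - 1 / (b 0 * lam + ?y)" by (intro divide_neg_neg) auto
    then show ?thesis using x eq s_neg[OF j(1,2)] by linarith
  next
    case 2
    with j have "j \<noteq> 1" by auto
    from 2 j obtain i where i: "i < j" "b i \<noteq> 1" by blast
    with 2 obtain i' where i': "i = Suc i'" by (cases i) auto
    have "- 1 / (lam + ?y) = - 1 / (lam + s (j - 1))"
      using x eq 2 s_Suc[of "j - 1"] j by simp
    then have "?y = s (j - 1)" by (simp add: divide_eq_eq_1)
    then show ?thesis using \<open>j \<noteq> 1\<close> 2 i i' by (auto simp: shift_def intro!: exI[of _ i'])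
  next
    case 3
    have y: "1 - lam \<le> ?y" using st 3 by (simp add: digit_step_def)
    have bl: "2 * lam \<le> b 0 * lam" using 3 lam_gt_1 by (intro mult_right_mono) auto
    \<comment> \<open>As \<open>s\<close> is strictly decreasing, this leaves only
      \<open>j = 1\<close>.\<close>
    have "s 1 \<le> s j"
      unfolding eq[symmetric] x s_1
    proof (rule neg_inverse_mono)
      show "lam + 1 \<le> b 0 * lam + ?y" using bl y by linarith
    qed (use lam_gt_1 in auto)
    then have "j = 1" using s_strict_antimono[of 1 j] j by (cases "j = 1") auto
    then have den: "b 0 * lam + ?y = lam + 1"
      using x eq s_1 by simp
    have "b 0 = 2"
    proof (rule ccontr)
      assume "b 0 \<noteq> 2"
      then have "3 * lam \<le> b 0 * lam" using 3 lam_gt_1 by (intro mult_right_mono) auto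
      then show False using den y lam_gt_1 by linarith
    qed
    then show ?thesis using \<open>j = 1\<close> den A_no_ones[OF b] s_h by auto
  qed
qed

lemma r_seq_eq: "r_seq q i = (if Suc (i mod h) = h then 2 else 1)"
proof -
  have m: "i mod h < h" using h_pos by simp
  have e: "r_seq q i = (replicate (h - 1) 1 @ [2]) ! (i mod h)"
    using h_pos by (simp add: r_seq_def periodic_seq_def)
  show ?thesis
  proof (cases "Suc (i mod h) = h")
    case True
    then have "i mod h = h - 1" by simp
    then show ?thesis unfolding e using True by (simp add: nth_append)
  next
    case False
    then have "i mod h < h - 1" using m by simp
    then show ?thesis unfolding e using False by (simp add: nth_append)
  qed
qed

text \<open>The hypothesis on leading ones excludes the expansions of \<open>r_q\<close> that begin
  with \<open>h\<close> ones and continue with a tail of value 1.\<close>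

lemma inf_cf_eq_r:
  assumes b: "b \<in> A_dreg q" and ones: "\<not> (\<forall>i<h. b i = 1)" and eq: "inf_cf q b = 1 - lam"
  shows "b = r_seq q"
proof
  fix i
  define c where "c i = (shift ^^ i) b" for i
  have c: "c i \<in> A_dreg q" "c i 0 = b i" "shift (c i) = c (Suc i)" for i
    using A_shift_pow[OF b] by (simp_all add: c_def shift_pow)
  have mh: "i mod h < h" for i using h_pos by simp
  \<comment> \<open>The index of \<open>s\<close> counts down from \<open>h\<close> to 1 while the
    digits are 1; the digit 2 resets it to \<open>h\<close>.\<close>
  have inv: "inf_cf q (c i) = s (h - i mod h) \<and> \<not> (\<forall>k<h - i mod h. c i k = 1)" for i
  proof (induction i)
    case 0
    then show ?case using ones eq s_h by (simp add: c_def)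
  next
    case (Suc i)
    have j: "1 \<le> h - i mod h" "h - i mod h \<le> Suc h" using mh[of i] by auto
    note st = inf_cf_eq_s[OF c(1)[of i] j, unfolded c(3)]
    show ?case
    proof (cases "Suc (i mod h) = h")
      case True
      then have "h - i mod h = 1" "Suc i mod h = 0" by (auto simp: mod_Suc)
      then show ?thesis using st Suc by simp
    next
      case False
      then have "h - i mod h \<noteq> 1" "h - Suc i mod h = h - i mod h - 1"
        using mh[of i] by (auto simp: mod_Suc)
      then show ?thesis using st Suc by simp
    qed
  qed
  have j: "1 \<le> h - i mod h" "h - i mod h \<le> Suc h" using mh[of i] by auto
  have "h - i mod h = 1 \<longleftrightarrow> Suc (i mod h) = h" using mh[of i] by auto
  then show "b i = r_seq q i"
    using inf_cf_eq_s[OF c(1)[of i] j] inv[of i] c(2) by (simp add: r_seq_eq split: if_splits)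
qed

text \<open>Each digit 1 moves one step back along the orbit of 1, and the digit 2 leads from
  \<open>s 1\<close> to \<open>s h\<close> because \<open>2 * lam + (1 - lam) = lam + 1\<close>.
  Thus \<open>r_seq\<close> encodes \<open>s h\<close>, which is \<open>r_q\<close>.\<close>

lemma r_orbit: "orbit N (r_seq q) (\<lambda>i. s (h - i mod h))"
proof -
  have mh: "i mod h < h" for i using h_pos by simp
  have bd: "\<bar>s j\<bar> \<le> 1" "1 - lam \<le> s j" if "1 \<le> j" "j \<le> h" for j
  proof -
    show "\<bar>s j\<bar> \<le> 1" using s_ge_m1[of j] s_neg[of j] that by auto
    show "1 - lam \<le> s j" using s_strict_antimono[of j h] s_h that by (cases "j = h") auto
  qed
  have "digit_step (r_seq q i) (s (h - i mod h)) (s (h - Suc i mod h))" for i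
  proof (cases "Suc (i mod h) = h")
    case True
    then have "h - i mod h = 1" "Suc i mod h = 0" by (auto simp: mod_Suc)
    then show ?thesis using True bd[of h] h_pos
      by (simp add: digit_step_def r_seq_eq s_1[simplified] s_h)
  next
    case False
    then have e: "h - i mod h = Suc (h - Suc i mod h)" "1 \<le> h - Suc i mod h"
      using mh[of i] by (auto simp: mod_Suc)
    show ?thesis using False bd[of "h - Suc i mod h"] s_Suc[of "h - Suc i mod h"] e
      by (simp add: digit_step_def r_seq_eq)
  qed
  then show ?thesis using bd[of h] h_pos by (simp add: orbit_def)
qed

text \<open>Counterpart of \<open>cf_lower\<close>: applying the strictly increasing
  \<open>S\<close> to \<open>x j < 1\<close> exactly \<open>j\<close> times gives the bound. For
  \<open>j = h\<close> it contradicts a value at least \<open>r_q\<close>.\<close>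

lemma ones_upper:
  "(\<And>k. k < j \<Longrightarrow> digit_step 1 (x k) (x (Suc k))) \<Longrightarrow> x j < 1 \<Longrightarrow> j \<le> Suc h \<Longrightarrow> x 0 < s j"
proof (induction j arbitrary: x)
  case 0
  then show ?case by (simp add: s_0)
next
  case (Suc j)
  have st: "digit_step 1 (x 0) (x 1)" using Suc.prems(1)[of 0] by simp
  have "x 1 < s j" using Suc.IH[of "\<lambda>i. x (Suc i)"] Suc.prems by simp
  then have "- 1 / (lam + x 1) < - 1 / (lam + s j)"
    using st lam_gt_1 by (intro neg_inverse_strict_mono) (auto simp: digit_step_def)
  then show ?case using st s_Suc[of j] Suc.prems by (simp add: digit_step_def)
qed

section \<open>The dual floor, the map \<open>f_dual\<close> and the intervals
  \<open>J\<close>\<close>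

lemma dual_floor_nonneg_eq:
  assumes "of_int n * lam + (1 - lam) \<le> x" "x < of_int n * lam + 1"
  shows "dual_floor_nonneg q x = n"
  unfolding dual_floor_nonneg_def r_q_def R_q_def
proof (rule the_equality)
  fix m :: int
  assume m: "of_int m * lam + (1 - lam) \<le> x \<and> x < of_int m * lam + 1"
  have "of_int m * lam < (of_int n + 1) * lam" "of_int n * lam < (of_int m + 1) * lam"
    using m assms by (auto simp: algebra_simps)
  then have "real_of_int m < of_int n + 1" "real_of_int n < of_int m + 1"
    using lam_gt_1 by auto
  then show "m = n" by linarith
qed (use assms in auto)

lemma digit_exists: "\<exists>n. of_int n * lam + (1 - lam) \<le> x \<and> x < of_int n * lam + 1"
proof -
  define z where "z = (x - (1 - lam)) / lam"
  have "of_int \<lfloor>z\<rfloor> * lam \<le> z * lam"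
    using lam_gt_1 by (intro mult_right_mono) auto
  moreover have "z * lam < (of_int \<lfloor>z\<rfloor> + 1) * lam"
    using lam_gt_1 by (intro mult_strict_right_mono) auto
  moreover have "z * lam = x - (1 - lam)" using lam_gt_1 by (simp add: z_def)
  ultimately show ?thesis
    by (intro exI[of _ "\<lfloor>z\<rfloor>"]) (auto simp: algebra_simps)
qed

lemma dual_floor_neg: "x \<noteq> 0 \<Longrightarrow> dual_floor q (- x) = - dual_floor q x"
  by (simp add: dual_floor_def)

lemma f_dual_neg: "f_dual q (- y) = - f_dual q y"
  using dual_floor_neg[of "- 1 / y"] by (simp add: f_dual_def)

text \<open>The strict bound on \<open>t\<close> matches the half-open intervals of the dual floor,
  so \<open>d\<close> is the floor of \<open>- 1 / y\<close> and \<open>t\<close> the remainder.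
  Negative digits follow by symmetry.\<close>

lemma digit_step_floor:
  assumes "digit_step d y t" "\<bar>t\<bar> < 1"
  shows "dual_floor q (- 1 / y) = d" and "f_dual q y = t"
proof -
  have *: "dual_floor q (- 1 / y) = d" if "digit_step d y t" "\<bar>t\<bar> < 1" "0 < d" for d y t
  proof -
    have y: "- 1 / y = d * lam + t" using that by (simp add: digit_step_def)
    have "1 * lam \<le> d * lam" using that lam_gt_1 by (intro mult_right_mono) auto
    then have "0 \<le> d * lam + t" using that lam_gt_1 by linarith
    moreover have "dual_floor_nonneg q (d * lam + t) = d"
      using that by (intro dual_floor_nonneg_eq) (auto simp: digit_step_def)
    ultimately show ?thesis unfolding y by (simp add: dual_floor_def)
  qed
  show fl: "dual_floor q (- 1 / y) = d"
  proof (cases "0 < d")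
    case True
    then show ?thesis using * assms by blast
  next
    case False
    then have "0 < - d" using assms by (auto simp: digit_step_def)
    then have "dual_floor q (- 1 / (- y)) = - d"
      using *[of "- d" "- y" "- t"] assms digit_step_neg by simp
    then show ?thesis
      using dual_floor_neg[of "- 1 / y"] digit_step_nz[OF assms(1)] by simp
  qed
  have "- 1 / y = d * lam + t" using assms by (simp add: digit_step_def)
  then show "f_dual q y = t"
    using digit_step_nz[OF assms(1)] fl by (simp add: f_dual_def)
qed

lemma digit_step_dual:
  assumes "\<bar>y\<bar> \<le> 1" "y \<noteq> 0"
  obtains d where "digit_step d y (f_dual q y)" "\<bar>f_dual q y\<bar> < 1"
proof -
  have *: "\<exists>d t. digit_step d y t \<and> \<bar>t\<bar> < 1" if "- 1 \<le> y" "y < 0" for y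
  proof -
    obtain n where n: "of_int n * lam + (1 - lam) \<le> - 1 / y" "- 1 / y < of_int n * lam + 1"
      using digit_exists by blast
    have "1 \<le> - 1 / y" using that by (simp add: field_simps)
    then have "0 < of_int n * lam" using n by linarith
    then have "0 < n" using lam_gt_1 by (simp add: zero_less_mult_iff)
    define t where "t = - 1 / y - n * lam"
    have t: "1 - lam \<le> t" "t < 1" using n by (auto simp: t_def)
    moreover have "y = - 1 / (n * lam + t)" using that by (simp add: t_def)
    ultimately have "digit_step n y t" "\<bar>t\<bar> < 1"
      using \<open>0 < n\<close> lam_less_2 by (auto simp: digit_step_def)
    then show ?thesis by blast
  qed
  have "\<exists>d t. digit_step d y t \<and> \<bar>t\<bar> < 1"
  proof (cases "y < 0")
    case True
    then show ?thesis using * assms by auto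
  next
    case False
    then obtain d t where "digit_step d (- y) t" "\<bar>t\<bar> < 1" using *[of "- y"] assms by auto
    then have "digit_step (- d) y (- t)" "\<bar>- t\<bar> < 1" using digit_step_neg[of d "- y" t] by auto
    then show ?thesis by blast
  qed
  then show ?thesis using that digit_step_floor by metis
qed

text \<open>For \<open>t = \<plusminus>1\<close> the point \<open>y\<close> is the common end point of two neighbouring intervals \<open>J\<close>, so
  its digit is ambiguous; the hypotheses exclude this case because \<open>f_dual\<close> maps such a point to
  \<open>\<plusminus>r_q\<close>.\<close>

lemma digit_step_f_dual:
  assumes "digit_step d y t" "f_dual q y \<noteq> 1 - lam" "f_dual q y \<noteq> lam - 1"
  shows "d = dual_floor q (- 1 / y)" and "t = f_dual q y"
proof -
  have *: "t < 1" if "digit_step d y t" "f_dual q y \<noteq> 1 - lam" for d y t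
  proof (rule ccontr)
    assume "\<not> t < 1"
    then have t: "t = 1" using that by (auto simp: digit_step_def)
    then have d: "0 < d" using that lam_less_2 by (auto simp: digit_step_def)
    \<comment> \<open>Remainder 1 at digit \<open>d\<close> is remainder \<open>1 - lam\<close> at
      digit \<open>d + 1\<close>, and the half-open interval selects the latter.\<close>
    have "digit_step (d + 1) y (1 - lam)"
      using that t d lam_less_2 lam_gt_1 by (auto simp: digit_step_def algebra_simps)
    then show False using digit_step_floor(2) that lam_gt_1 lam_less_2 by auto
  qed
  have "- t < 1"
    using *[of "- d" "- y" "- t"] assms digit_step_neg by (auto simp: f_dual_neg)
  then have "\<bar>t\<bar> < 1" using *[OF assms(1,2)] by auto
  then show "d = dual_floor q (- 1 / y)" and "t = f_dual q y"
    using digit_step_floor[OF assms(1)] by auto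
qed

lemma J_dual_iff: "y \<in> J_dual q m \<longleftrightarrow> (\<exists>t. digit_step m y t)"
proof -
  have *: "y \<in> J_dual_pos q m \<longleftrightarrow> (\<exists>t. digit_step m y t)" if m: "1 \<le> m" for y m
  proof -
    have ml: "1 * lam \<le> m * lam" using that lam_gt_1 by (intro mult_right_mono) auto
    \<comment> \<open>The denominators \<open>m * lam + t\<close> at the extreme remainders
      \<open>t = 1 - lam\<close> and \<open>t = 1\<close>, which give the end points of the
      interval.\<close>
    define A B where "A = 1 - lam + m * lam" and "B = 1 - lam + of_int (m + 1) * lam"
    have B: "B = 1 + m * lam" by (simp add: B_def algebra_simps)
    have AB: "0 < A" "0 < B" using ml lam_gt_1 unfolding A_def B by linarith+
    have J: "y \<in> J_dual_pos q m \<longleftrightarrow> - 1 / A \<le> y \<and> y \<le> - 1 / B"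
      by (simp add: J_dual_pos_def r_q_def A_def B_def)
    show ?thesis
    proof
      assume "y \<in> J_dual_pos q m"
      then have y: "- 1 / A \<le> y" "y \<le> - 1 / B" using J by auto
      moreover have "- 1 / B < 0" using AB by (intro divide_neg_pos) auto
      ultimately have "y < 0" by linarith
      have "A \<le> - 1 / y" "- 1 / y \<le> B" using y \<open>y < 0\<close> AB by (auto simp: field_simps)
      moreover have "y = - 1 / (m * lam + (- 1 / y - m * lam))" using \<open>y < 0\<close> by simp
      ultimately have "digit_step m y (- 1 / y - m * lam)"
        using that lam_less_2 unfolding digit_step_def A_def B by auto
      then show "\<exists>t. digit_step m y t" by blast
    next
      assume "\<exists>t. digit_step m y t"
      then obtain t where t: "y = - 1 / (m * lam + t)" "1 - lam \<le> t" "t \<le> 1"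
        using m by (auto simp: digit_step_def)
      have "A \<le> m * lam + t" "m * lam + t \<le> B"
        using t by (auto simp: A_def B)
      then have "- 1 / A \<le> y" "y \<le> - 1 / B"
        unfolding t(1) using AB by (auto intro!: neg_inverse_mono simp del: divide_minus_left)
      then show "y \<in> J_dual_pos q m" using J by simp
    qed
  qed
  consider "1 \<le> m" | "m = 0" | "m \<le> - 1" by linarith
  then show ?thesis
  proof cases
    case 1
    then show ?thesis using * by (simp add: J_dual_def)
  next
    case 2
    then show ?thesis by (simp add: J_dual_def digit_step_def)
  next
    case 3
    have "y \<in> uminus ` J_dual_pos q (- m) \<longleftrightarrow> - y \<in> J_dual_pos q (- m)"
      by (metis image_iff minus_minus)
    also have "\<dots> \<longleftrightarrow> (\<exists>t. digit_step (- m) (- y) (- (- t)))"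
      using *[of "- m" "- y"] 3 by simp
    also have "\<dots> \<longleftrightarrow> (\<exists>t. digit_step m y (- t))" using digit_step_neg[of m y] by metis
    also have "\<dots> \<longleftrightarrow> (\<exists>t. digit_step m y t)" by (metis minus_minus)
    finally show ?thesis using 3 by (simp add: J_dual_def)
  qed
qed

section \<open>The coding map away from the boundary orbits\<close>

definition D :: "real set" where "D = I_R q - boundary_J q"

lemma D_iff: "x \<in> D \<longleftrightarrow> \<bar>x\<bar> \<le> 1 \<and>
    (\<forall>n. (f_dual q ^^ n) x \<noteq> 1 - lam \<and> (f_dual q ^^ n) x \<noteq> lam - 1 \<and> (f_dual q ^^ n) x \<noteq> 0)"
  by (auto simp: D_def I_R_def boundary_J_def R_q_def r_q_def)

lemma D_nz: "x \<in> D \<Longrightarrow> x \<noteq> 0"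
  unfolding D_iff by (metis funpow_0)

lemma D_f_dual: "x \<in> D \<Longrightarrow> f_dual q x \<in> D"
  using digit_step_dual[of x] D_nz[of x] unfolding D_iff
  by (metis funpow_Suc_right comp_apply less_imp_le)

lemma D_f_dual_pow: "x \<in> D \<Longrightarrow> (f_dual q ^^ n) x \<in> D"
  by (induction n) (auto simp: D_f_dual)

lemma D_neq_r: "x \<in> D \<Longrightarrow> x \<noteq> 1 - lam" "x \<in> D \<Longrightarrow> x \<noteq> lam - 1"
  unfolding D_iff by (metis funpow_0)+

text \<open>The points 1 and -1 are mapped to \<open>- r_q\<close> and \<open>r_q\<close>, so they
  belong to the boundary set.\<close>

lemma D_less_1: "x \<in> D \<Longrightarrow> \<bar>x\<bar> < 1"
proof -
  assume x: "x \<in> D"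
  have "digit_step 1 (- 1) (1 - lam)" using lam_less_2 lam_gt_1 by (simp add: digit_step_def)
  then have "f_dual q (- 1) = 1 - lam" using digit_step_floor(2) lam_less_2 lam_gt_1 by auto
  moreover from this have "f_dual q 1 = lam - 1" using f_dual_neg[of 1] by simp
  ultimately have "x \<noteq> - 1" "x \<noteq> 1" using D_neq_r[OF D_f_dual[OF x]] by auto
  then show ?thesis using x unfolding D_iff by auto
qed

text \<open>Every orbit point is nonzero, so it has a digit; its image is not \<open>r_q\<close> or
  \<open>- r_q\<close>, so the digit is unique. This makes the description in \<open>pi_hat\<close>
  meaningful.\<close>

lemma D_coding_iff: "x \<in> D \<Longrightarrow> is_coding q x b \<longleftrightarrow> b = (\<lambda>i. dual_floor q (- 1 / (f_dual q ^^ i) x))"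
proof -
  assume x: "x \<in> D"
  have "(\<exists>t. digit_step d ((f_dual q ^^ i) x) t) \<longleftrightarrow> d = dual_floor q (- 1 / (f_dual q ^^ i) x)" for d i
  proof -
    let ?y = "(f_dual q ^^ i) x"
    have y: "?y \<in> D" using D_f_dual_pow[OF x] .
    obtain d' where d': "digit_step d' ?y (f_dual q ?y)"
      using digit_step_dual[of ?y] D_nz[OF y] D_less_1[OF y] by auto
    show ?thesis
      using digit_step_f_dual(1)[OF _ D_neq_r[OF D_f_dual[OF y]]] d' by metis
  qed
  then show ?thesis by (auto simp: is_coding_def J_dual_iff)
qed

lemma pi_hat_eq: "x \<in> D \<Longrightarrow> pi_hat q x = (\<lambda>i. dual_floor q (- 1 / (f_dual q ^^ i) x))"
  unfolding pi_hat_def by (rule the_equality) (auto simp: D_coding_iff)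

lemma pi_hat_f_dual: "x \<in> D \<Longrightarrow> pi_hat q (f_dual q x) = shift (pi_hat q x)"
  by (simp add: pi_hat_eq D_f_dual shift_def funpow_swap1)

lemma pi_hat_step:
  assumes "x \<in> D"
  shows "digit_step (pi_hat q x i) ((f_dual q ^^ i) x) ((f_dual q ^^ Suc i) x)"
proof -
  let ?y = "(f_dual q ^^ i) x"
  have y: "?y \<in> D" using D_f_dual_pow[OF assms] .
  obtain d where d: "digit_step d ?y (f_dual q ?y)" "\<bar>f_dual q ?y\<bar> < 1"
    using digit_step_dual[of ?y] D_nz[OF y] D_less_1[OF y] by auto
  then show ?thesis using digit_step_floor(1)[OF d] pi_hat_eq[OF assms] by simp
qed

text \<open>A digit of sign \<open>e\<close> followed by \<open>h\<close> digits \<open>e\<close>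
  would put the value after it both below \<open>r_q\<close>, by \<open>ones_upper\<close>, and at
  or above it, by \<open>digit_step\<close>, up to the sign \<open>e\<close>.\<close>

lemma pi_hat_in_A:
  assumes x: "x \<in> D"
  shows "pi_hat q x \<in> A_dreg q"
proof -
  let ?b = "pi_hat q x"
  define y where "y i = (f_dual q ^^ i) x" for i
  have st: "digit_step (?b i) (y i) (y (Suc i))" for i
    using pi_hat_step[OF x] by (simp add: y_def)
  have yD: "y i \<in> D" for i using D_f_dual_pow[OF x] by (simp add: y_def)
  have lt: "\<bar>y i\<bar> < 1" and ne: "y i \<noteq> 1 - lam" "y i \<noteq> lam - 1" for i
    using D_less_1[OF yD] D_neq_r[OF yD] by auto
  have "\<not> (\<forall>k<h. ?b (Suc (l + k)) = e)" if e: "e \<in> {1, - 1}" "1 \<le> e * ?b l" for l e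
  proof
    assume ones: "\<forall>k<h. ?b (Suc (l + k)) = e"
    \<comment> \<open>Multiplying by \<open>e\<close> reduces both signs to digits 1.\<close>
    let ?z = "\<lambda>k. e * y (Suc (l + k))"
    have "digit_step 1 (?z k) (?z (Suc k))" if "k < h" for k
      using st[of "Suc (l + k)"] digit_step_neg[of "-1" "y (Suc (l + k))"] ones that e by auto
    moreover have "?z h < 1" using lt[of "Suc (l + h)"] e by auto
    ultimately have "?z 0 < s h" using ones_upper[of h ?z] by simp
    moreover have "1 - lam \<le> e * y (Suc l)" using st[of l] e by (auto simp: digit_step_def)
    ultimately show False by (simp add: s_h)
  qed
  moreover have "?b i \<noteq> 0" for i using st[of i] by (simp add: digit_step_def)
  ultimately show ?thesis unfolding A_dreg_iff by blast
qed

lemma pi_hat_orbit: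
  assumes x: "x \<in> D"
  shows "orbit N (pi_hat q x) (\<lambda>i. (f_dual q ^^ i) x)"
  using pi_hat_step[OF x] D_less_1[OF x] by (simp add: orbit_def)

lemma inf_cf_pi_hat: "x \<in> D \<Longrightarrow> inf_cf q (pi_hat q x) = x"
  using orbit_cf_tendsto[OF pi_hat_in_A pi_hat_orbit, of x] unfolding inf_cf_def
  by (simp add: limI)

text \<open>By uniqueness of orbits, a point coded by \<open>r_seq\<close> or its negative is
  \<open>r_q\<close> or \<open>- r_q\<close>.\<close>

lemma pi_hat_neq_r:
  assumes x: "x \<in> D"
  shows "pi_hat q x \<noteq> r_seq q" and "pi_hat q x \<noteq> (\<lambda>i. - r_seq q i)"
proof -
  show "pi_hat q x \<noteq> r_seq q"
    using orbit_unique[OF r_orbit, of "\<lambda>i. (f_dual q ^^ i) x"] pi_hat_orbit[OF x] D_neq_r[OF x] s_h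
    by auto
  show "pi_hat q x \<noteq> (\<lambda>i. - r_seq q i)"
  proof
    assume eq: "pi_hat q x = (\<lambda>i. - r_seq q i)"
    have "orbit N (r_seq q) (\<lambda>i. - (f_dual q ^^ i) x)" for N
      using pi_hat_orbit[OF x, of N] unfolding eq orbit_def
      using digit_step_neg by fastforce
    then show False
      using orbit_unique[OF r_orbit, of "\<lambda>i. - (f_dual q ^^ i) x"] D_neq_r[OF x] s_h by auto
  qed
qed

lemma pi_hat_f_dual_pow: "x \<in> D \<Longrightarrow> pi_hat q ((f_dual q ^^ n) x) = (shift ^^ n) (pi_hat q x)"
  by (induction n) (auto simp: pi_hat_f_dual D_f_dual_pow)

section \<open>The continued fraction as inverse of the coding map\<close>

definition E :: "(nat \<Rightarrow> int) set" where "E = A_dreg q - eventually_r q"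

lemma E_iff: "b \<in> E \<longleftrightarrow> b \<in> A_dreg q \<and>
    (\<forall>n. (shift ^^ n) b \<noteq> r_seq q \<and> (shift ^^ n) b \<noteq> (\<lambda>i. - r_seq q i))"
  by (auto simp: E_def eventually_r_def)

lemma E_A: "b \<in> E \<Longrightarrow> b \<in> A_dreg q"
  by (simp add: E_def)

lemma pi_hat_in_E: "x \<in> D \<Longrightarrow> pi_hat q x \<in> E"
  unfolding E_iff using pi_hat_in_A pi_hat_neq_r[OF D_f_dual_pow] pi_hat_f_dual_pow by simp

lemma E_shift: "b \<in> E \<Longrightarrow> shift b \<in> E"
  unfolding E_iff by (metis A_shift funpow_Suc_right comp_apply)

lemma E_shift_pow: "b \<in> E \<Longrightarrow> (shift ^^ n) b \<in> E"
  by (induction n) (auto simp: E_shift)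

lemma E_neg:
  assumes "b \<in> E"
  shows "(\<lambda>i. - b i) \<in> E"
proof -
  have sh: "(shift ^^ n) (\<lambda>i. - b i) = (\<lambda>i. - (shift ^^ n) b i)" for n
    by (simp add: shift_pow fun_eq_iff)
  have "(\<lambda>i. - c i) = d \<longleftrightarrow> c = (\<lambda>i. - d i)" for c d :: "nat \<Rightarrow> int"
    by auto
  then show ?thesis using assms A_neg unfolding E_iff sh by fastforce
qed

text \<open>The value -1 is \<open>s (Suc h)\<close>, so it forces a digit 1 followed by the
  sequence \<open>r_seq\<close>. The value 1 reduces to this by negation.\<close>

lemma E_inf_cf_less_1:
  assumes b: "b \<in> E"
  shows "\<bar>inf_cf q b\<bar> < 1"
proof -
  have *: "inf_cf q b \<noteq> - 1" if "b \<in> E" for b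
  proof
    assume eq: "inf_cf q b = - 1"
    have A: "b \<in> A_dreg q" using that by (rule E_A)
    have "inf_cf q (shift b) = 1 - lam \<and> \<not> (\<forall>i<h. shift b i = 1)"
      using inf_cf_eq_s[OF A, of "Suc h"] A_no_ones_start[OF A] eq s_Suc_h s_h h_pos by auto
    then have "shift b = r_seq q" using inf_cf_eq_r[OF A_shift[OF A]] by blast
    then show False using that unfolding E_iff by (metis funpow_0 funpow_Suc_right comp_apply)
  qed
  show ?thesis
    using *[OF b] *[OF E_neg[OF b]] inf_cf_bounded[OF E_A[OF b]] inf_cf_neg[OF E_A[OF b]] by auto
qed

text \<open>With \<open>h\<close> leading ones the value is strictly below \<open>r_q\<close>,
  because the tail after them is strictly below 1. Otherwise \<open>inf_cf_eq_r\<close> identifies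
  the sequence as \<open>r_seq\<close>.\<close>

lemma E_inf_cf_neq_r:
  assumes b: "b \<in> E"
  shows "inf_cf q b \<noteq> 1 - lam" and "inf_cf q b \<noteq> lam - 1"
proof -
  have *: "inf_cf q b \<noteq> 1 - lam" if "b \<in> E" for b
  proof
    assume eq: "inf_cf q b = 1 - lam"
    have A: "b \<in> A_dreg q" using that by (rule E_A)
    show False
    proof (cases "\<forall>i<h. b i = 1")
      case True
      have "digit_step 1 (inf_cf q ((shift ^^ k) b)) (inf_cf q ((shift ^^ Suc k) b))"
        if "k < h" for k
        using inf_cf_orbit_step[OF A, of k] True that by simp
      moreover have "inf_cf q ((shift ^^ h) b) < 1"
        using E_inf_cf_less_1[OF E_shift_pow[OF that, of h]] by simp
      ultimately have "inf_cf q ((shift ^^ 0) b) < s h"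
        using ones_upper[of h "\<lambda>i. inf_cf q ((shift ^^ i) b)"] by simp
      then show False using eq s_h by simp
    next
      case False
      then have "b = r_seq q" using inf_cf_eq_r[OF A _ eq] by blast
      then show False using that unfolding E_iff by (metis funpow_0)
    qed
  qed
  show "inf_cf q b \<noteq> 1 - lam" using *[OF b] .
  show "inf_cf q b \<noteq> lam - 1" using *[OF E_neg[OF b]] inf_cf_neg[OF E_A[OF b]] by auto
qed

text \<open>All tail values are strictly between -1 and 1, so no end point ambiguity arises and
  \<open>f_dual\<close> removes exactly the first digit.\<close>

lemma E_f_dual_pow: "b \<in> E \<Longrightarrow> (f_dual q ^^ n) (inf_cf q b) = inf_cf q ((shift ^^ n) b)"
proof (induction n)
  case (Suc n)
  then show ?case
    using digit_step_floor(2)[OF inf_cf_orbit_step[of b n] E_inf_cf_less_1[OF E_shift_pow]] E_A by auto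
qed simp

lemma inf_cf_in_D:
  assumes b: "b \<in> E"
  shows "inf_cf q b \<in> D"
proof -
  have "inf_cf q ((shift ^^ n) b) \<noteq> 0" for n
    using digit_step_nz[OF inf_cf_orbit_step[OF E_A[OF b]]] .
  then show ?thesis
    using E_inf_cf_less_1[OF b] E_inf_cf_neq_r[OF E_shift_pow[OF b]] E_f_dual_pow[OF b]
    unfolding D_iff by simp
qed

lemma pi_hat_inf_cf:
  assumes b: "b \<in> E"
  shows "pi_hat q (inf_cf q b) = b"
proof
  fix i
  show "pi_hat q (inf_cf q b) i = b i"
    using digit_step_floor(1)[OF inf_cf_orbit_step[OF E_A[OF b], of i] E_inf_cf_less_1[OF E_shift_pow[OF b]]]
    by (simp add: pi_hat_eq[OF inf_cf_in_D[OF b]] E_f_dual_pow[OF b])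
qed

lemma pi_hat_bij: "bij_betw (pi_hat q) D E"
  by (rule bij_betw_byWitness[where f' = "inf_cf q"])
    (auto simp: inf_cf_pi_hat pi_hat_inf_cf pi_hat_in_E inf_cf_in_D)

end

theorem lemma4p4p1:
  fixes q :: nat
  assumes "q \<ge> 4" and "even q"
  shows "(\<forall>x \<in> I_R q - boundary_J q. \<exists>!b. is_coding q x b) \<and>
         bij_betw (pi_hat q) (I_R q - boundary_J q) (A_dreg q - eventually_r q) \<and>
         (\<forall>x \<in> I_R q - boundary_J q.
            f_dual q x \<in> I_R q - boundary_J q \<and>
            pi_hat q (f_dual q x) = shift (pi_hat q x)) \<and>
         (\<forall>b \<in> A_dreg q.
            (\<forall>n. fin_cf_defined (lambda_q q) (map b [0..<n])) \<and>
            convergent (convergent_cf q b) \<and>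
            inf_cf q b \<in> I_R q) \<and>
         (\<forall>b \<in> A_dreg q - eventually_r q.
            the_inv_into (I_R q - boundary_J q) (pi_hat q) b = inf_cf q b)"
proof -
  interpret even_hecke q using assms by unfold_locales
  have "inf_cf q b \<in> I_R q" if "b \<in> A_dreg q" for b
    using inf_cf_bounded[OF that] by (auto simp: I_R_def R_q_def)
  moreover have "the_inv_into D (pi_hat q) b = inf_cf q b" if "b \<in> E" for b
    using pi_hat_bij inf_cf_in_D[OF that] pi_hat_inf_cf[OF that]
    by (intro the_inv_into_f_eq) (auto simp: bij_betw_def)
  ultimately show ?thesis
    unfolding D_def[symmetric] E_def[symmetric]
    using pi_hat_bij by (simp add: D_coding_iff D_f_dual pi_hat_f_dual cf_defined cf_convergent)
qed

end
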